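(* Let $n\ge 1$, let $A\in\mathbb{H}^{n\times n}$ and $B\in\mathbb{H}^{n}$, and assume that the controllability matrix $\mathcal{C}=[B,AB,\dots,A^{n-1}B]\in\mathbb{H}^{n\times n}$ is invertible over $\mathbb{H}$. Then: 1. There exists an invertible matrix $T\in\mathbb{H}^{n\times n}$ such that, with $A_c=T^{-1}AT$ and $B_c=T^{-1}B$, the pair $(A_c,B_c)$ is in lower controllable companion form. In particular, coefficients $a_0,\dots,a_{n-1}\in\mathbb{H}$ are defined by the last row of $A_c$: $e_n^{\top}A_c=[-a_0,\,-a_1,\,\dots,\,-a_{n-1}]$. 2. The matrix $T$ is explicitly given by $$T^{-1}=\begin{bmatrix} t\\ tA\\ \vdots\\ tA^{n-1}\end{bmatrix},\qquad t=[0,0,\dots,0,1]\,\mathcal{C}^{-1}$$ (so $t\in\mathbb{H}^{1\times n}$ is the last row of $\mathcal{C}^{-1}$). 3. For the given pair $(A,B)$, the companion pair $(A_c,B_c)$ and the matrix $T$ are unique; that is, there is exactly one invertible $T\in\mathbb{H}^{n\times n}$ such that $(T^{-1}AT,\,T^{-1}B)$ is in lower controllable companion form.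
   Context: $\mathbb{H}$ denotes the real quaternions, a noncommutative division algebra. $\mathbb{H}^{n}$ is the set of column vectors of length $n$ over $\mathbb{H}$, $\mathbb{H}^{n\times n}$ the set of $n\times n$ matrices with the usual matrix product (order of factors matters). $e_i$ is the $i$-th canonical basis column vector. A pair $(A_c,B_c)$ with $A_c\in\mathbb{H}^{n\times n}$, $B_c\in\mathbb{H}^n$ is in lower controllable companion form if there are $a_0,\dots,a_{n-1}\in\mathbb{H}$ such that $$A_c=\begin{bmatrix}0&1&\cdots&0\\ \vdots&\vdots&\ddots&\vdots\\ 0&0&\cdots&1\\ -a_0&-a_1&\cdots&-a_{n-1}\end{bmatrix},\qquad B_c=\begin{bmatrix}0\\ \vdots\\ 0\\ 1\end{bmatrix},$$ i.e. $e_i^{\top}A_c=e_{i+1}^{\top}$ for $i=1,\dots,n-1$, $e_n^{\top}A_c=[-a_0,\dots,-a_{n-1}]$, and $B_c=e_n$. *)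

theory Defs
  imports Complex_Main "Jordan_Normal_Form.Matrix"
begin

text \<open>The real quaternions \<open>Re x + Im1 x i + Im2 x j + Im3 x k\<close>.\<close>

codatatype quat = Quat (Re: real) (Im1: real) (Im2: real) (Im3: real)

lemma quat_eq_iff: "x = y \<longleftrightarrow> Re x = Re y \<and> Im1 x = Im1 y \<and> Im2 x = Im2 y \<and> Im3 x = Im3 y"
  by (auto intro: quat.expand)

instantiation quat :: ab_group_add
begin

primcorec zero_quat where
  "Re 0 = 0" | "Im1 0 = 0" | "Im2 0 = 0" | "Im3 0 = 0"

primcorec plus_quat where
  "Re (x + y) = Re x + Re y"
| "Im1 (x + y) = Im1 x + Im1 y"
| "Im2 (x + y) = Im2 x + Im2 y"
| "Im3 (x + y) = Im3 x + Im3 y"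

primcorec uminus_quat where
  "Re (- x) = - Re x"
| "Im1 (- x) = - Im1 x"
| "Im2 (- x) = - Im2 x"
| "Im3 (- x) = - Im3 x"

primcorec minus_quat where
  "Re (x - y) = Re x - Re y"
| "Im1 (x - y) = Im1 x - Im1 y"
| "Im2 (x - y) = Im2 x - Im2 y"
| "Im3 (x - y) = Im3 x - Im3 y"

instance
  by standard (simp_all add: quat_eq_iff)

end

instantiation quat :: ring_1
begin

primcorec one_quat where
  "Re 1 = 1" | "Im1 1 = 0" | "Im2 1 = 0" | "Im3 1 = 0"

primcorec times_quat where
  "Re (x * y) = Re x * Re y - Im1 x * Im1 y - Im2 x * Im2 y - Im3 x * Im3 y"
| "Im1 (x * y) = Re x * Im1 y + Im1 x * Re y + Im2 x * Im3 y - Im3 x * Im2 y"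
| "Im2 (x * y) = Re x * Im2 y - Im1 x * Im3 y + Im2 x * Re y + Im3 x * Im1 y"
| "Im3 (x * y) = Re x * Im3 y + Im1 x * Im2 y - Im2 x * Im1 y + Im3 x * Re y"

instance
  by standard (simp_all add: quat_eq_iff algebra_simps)

end

definition quat_norm2 :: "quat \<Rightarrow> real" where
  "quat_norm2 x = (Re x)\<^sup>2 + (Im1 x)\<^sup>2 + (Im2 x)\<^sup>2 + (Im3 x)\<^sup>2"

lemma quat_norm2_eq_0_iff: "quat_norm2 x = 0 \<longleftrightarrow> x = 0"
  by (auto simp: quat_norm2_def quat_eq_iff add_nonneg_eq_0_iff)

instantiation quat :: division_ring
begin

primcorec inverse_quat where
  "Re (inverse x) = Re x / quat_norm2 x"
| "Im1 (inverse x) = - Im1 x / quat_norm2 x"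
| "Im2 (inverse x) = - Im2 x / quat_norm2 x"
| "Im3 (inverse x) = - Im3 x / quat_norm2 x"

definition divide_quat where
  "x div y = x * inverse (y :: quat)"

instance
proof
  fix x y :: quat
  show "inverse x * x = 1" if "x \<noteq> 0"
    using that unfolding quat_norm2_eq_0_iff [symmetric]
    by (simp add: quat_eq_iff add_divide_distrib [symmetric] diff_divide_distrib [symmetric])
       (simp add: quat_norm2_def power2_eq_square)
  show "x * inverse x = 1" if "x \<noteq> 0"
    using that unfolding quat_norm2_eq_0_iff [symmetric]
    by (simp add: quat_eq_iff add_divide_distrib [symmetric] diff_divide_distrib [symmetric])
       (simp add: quat_norm2_def power2_eq_square)
  show "x div y = x * inverse y"
    by (rule divide_quat_def)
  show "inverse (0 :: quat) = 0"
    by (simp add: quat_eq_iff)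
qed

end

text \<open>
  The two-sided inverse of an invertible square matrix over a possibly noncommutative ring
  (unspecified when the matrix is not invertible).
\<close>

definition mat_inv :: "'a :: semiring_1 mat \<Rightarrow> 'a mat" where
  "mat_inv M = (THE N. N \<in> carrier_mat (dim_row M) (dim_row M) \<and> inverts_mat M N \<and> inverts_mat N M)"

lemma mat_inv_props:
  fixes M :: "'a :: semiring_1 mat"
  assumes M: "M \<in> carrier_mat n n" and "invertible_mat M"
  shows "mat_inv M \<in> carrier_mat n n" "M * mat_inv M = 1\<^sub>m n" "mat_inv M * M = 1\<^sub>m n"
proof -
  let ?P = "\<lambda>N. N \<in> carrier_mat (dim_row M) (dim_row M) \<and> inverts_mat M N \<and> inverts_mat N M"
  obtain N where N: "M * N = 1\<^sub>m n" "N * M = 1\<^sub>m (dim_row N)"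
    using assms unfolding invertible_mat_def inverts_mat_def by auto
  have "dim_col N = n"
    using arg_cong[OF N(1), of dim_col] by simp
  moreover have "dim_row N = n"
    using arg_cong[OF N(2), of dim_col] M by simp
  ultimately have Nc: "N \<in> carrier_mat n n"
    by auto
  have uniq: "N' = N" if "?P N'" for N'
  proof -
    have N': "N' \<in> carrier_mat n n" "N' * M = 1\<^sub>m n"
      using that M by (auto simp: inverts_mat_def)
    have "N' = N' * (M * N)"
      using N N' by simp
    also have "\<dots> = (N' * M) * N"
      using assoc_mult_mat[OF N'(1) M Nc] by simp
    also have "\<dots> = N"
      using N' Nc by simp
    finally show ?thesis .
  qed
  have "?P N"
    using N Nc M by (auto simp: inverts_mat_def)
  then have "?P (mat_inv M)"
    unfolding mat_inv_def by (rule theI) (rule uniq)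
  then show "mat_inv M \<in> carrier_mat n n" "M * mat_inv M = 1\<^sub>m n" "mat_inv M * M = 1\<^sub>m n"
    using M by (auto simp: inverts_mat_def)
qed

definition controllability_mat :: "nat \<Rightarrow> 'a :: semiring_1 mat \<Rightarrow> 'a vec \<Rightarrow> 'a mat" where
  "controllability_mat n A B = mat_of_cols n (map (\<lambda>k. (A ^\<^sub>m k) *\<^sub>v B) [0..<n])"

text \<open>Rows and columns are indexed from \<open>0\<close>, so \<open>unit_vec n (n - 1)\<close> is the last basis vector.\<close>

definition lower_companion_mat :: "nat \<Rightarrow> (nat \<Rightarrow> 'a :: ring_1) \<Rightarrow> 'a mat" where
  "lower_companion_mat n a =
     mat n n (\<lambda>(i, j). if i = n - 1 then - a j else if j = i + 1 then 1 else 0)"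

definition lower_companion_form :: "nat \<Rightarrow> 'a :: ring_1 mat \<Rightarrow> 'a vec \<Rightarrow> bool" where
  "lower_companion_form n Ac Bc \<longleftrightarrow>
     (\<exists>a. Ac = lower_companion_mat n a) \<and> Bc = unit_vec n (n - 1)"

definition companion_transform :: "nat \<Rightarrow> 'a :: ring_1 mat \<Rightarrow> 'a vec \<Rightarrow> 'a mat \<Rightarrow> bool" where
  "companion_transform n A B T \<longleftrightarrow>
     T \<in> carrier_mat n n \<and> invertible_mat T \<and>
     lower_companion_form n (mat_inv T * A * T) (mat_inv T *\<^sub>v B)"

text \<open>The row vector \<open>[0, \<dots>, 0, 1] C\<^sup>-\<^sup>1\<close>, as a \<open>1 \<times> n\<close> matrix.\<close>

definition companion_row :: "nat \<Rightarrow> 'a :: semiring_1 mat \<Rightarrow> 'a vec \<Rightarrow> 'a mat" where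
  "companion_row n A B = mat_of_row (unit_vec n (n - 1)) * mat_inv (controllability_mat n A B)"

definition row_krylov_mat :: "nat \<Rightarrow> 'a :: semiring_1 mat \<Rightarrow> 'a mat \<Rightarrow> 'a mat" where
  "row_krylov_mat n t A = mat_of_rows n (map (\<lambda>k. row (t * A ^\<^sub>m k) 0) [0..<n])"

end

theory Submission
  imports Defs
begin

text \<open>
  Let \<open>C\<close> be the controllability matrix, \<open>t\<close> the last row of its inverse and \<open>K\<close> the matrix with
  rows \<open>t A\<^sup>i\<close>. The \<open>(i, j)\<close> entry of \<open>K C\<close> is \<open>t A\<^sup>i\<^sup>+\<^sup>j B\<close>, which is \<open>0\<close> above the antidiagonal
  and \<open>1\<close> on it because \<open>t C\<close> is the last unit row vector. Such a matrix is invertible over any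
  ring: reversing its columns gives \<open>1 - N\<close> with \<open>N\<close> strictly lower triangular, hence nilpotent.
  So \<open>K\<close> is invertible, and \<open>T = K\<^sup>-\<^sup>1\<close> works. Conversely, if \<open>T\<close> yields a companion pair, the rows
  \<open>s\<^sub>i\<close> of \<open>T\<^sup>-\<^sup>1\<close> satisfy \<open>s\<^sub>i\<^sub>+\<^sub>1 = s\<^sub>i A\<close>, and since \<open>T\<^sup>-\<^sup>1 B\<close> is the last unit vector, \<open>s\<^sub>0 C\<close>
  is the last unit row vector, so that \<open>s\<^sub>0 = t\<close> and \<open>T\<^sup>-\<^sup>1 = K\<close>.
\<close>

section \<open>Matrix powers and two-sided inverses over a ring\<close>

lemma pow_mat_add:
  fixes A :: "'a :: semiring_1 mat"
  assumes "A \<in> carrier_mat n n"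
  shows "A ^\<^sub>m (i + j) = A ^\<^sub>m i * A ^\<^sub>m j"
proof (induction j)
  case 0
  then show ?case using assms by simp
next
  case (Suc j)
  have "A ^\<^sub>m i \<in> carrier_mat n n" "A ^\<^sub>m j \<in> carrier_mat n n"
    using assms by simp_all
  then show ?case
    using Suc assoc_mult_mat[OF _ _ assms] by simp
qed

lemma invertible_matI:
  fixes M :: "'a :: semiring_1 mat"
  assumes "M \<in> carrier_mat n n" "N \<in> carrier_mat n n" "M * N = 1\<^sub>m n" "N * M = 1\<^sub>m n"
  shows "invertible_mat M"
  unfolding invertible_mat_def inverts_mat_def using assms by auto

lemma mat_inv_eqI:
  fixes M :: "'a :: semiring_1 mat"
  assumes M: "M \<in> carrier_mat n n" and N: "N \<in> carrier_mat n n" and MN: "M * N = 1\<^sub>m n" and NM: "N * M = 1\<^sub>m n"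
  shows "mat_inv M = N"
proof -
  note inv = mat_inv_props[OF M invertible_matI[OF assms]]
  have "mat_inv M = (N * M) * mat_inv M"
    using NM inv(1) by simp
  also have "\<dots> = N"
    using assoc_mult_mat[OF N M inv(1)] inv(2) N by simp
  finally show ?thesis .
qed

lemma invertible_mat_mult:
  fixes M N :: "'a :: semiring_1 mat"
  assumes M: "M \<in> carrier_mat n n" "invertible_mat M" and N: "N \<in> carrier_mat n n" "invertible_mat N"
  shows "invertible_mat (M * N)"
proof -
  note iM = mat_inv_props[OF M] and iN = mat_inv_props[OF N]
  have "(M * N) * (mat_inv N * mat_inv M) = M * ((N * mat_inv N) * mat_inv M)"
    using assoc_mult_mat[OF M(1) N(1), of "mat_inv N * mat_inv M" n]
      assoc_mult_mat[OF N(1) iN(1) iM(1)] iM(1) iN(1) by simp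
  moreover have "(mat_inv N * mat_inv M) * (M * N) = mat_inv N * ((mat_inv M * M) * N)"
    using assoc_mult_mat[OF iN(1) iM(1), of "M * N" n]
      assoc_mult_mat[OF iM(1) M(1) N(1)] M(1) N(1) by simp
  ultimately show ?thesis
    using M(1) N(1) iM iN
    by (intro invertible_matI[of _ n "mat_inv N * mat_inv M"]) (simp_all del: assoc_mult_mat)
qed

lemma invertible_mat_inv:
  fixes M :: "'a :: semiring_1 mat"
  assumes "M \<in> carrier_mat n n" "invertible_mat M"
  shows "invertible_mat (mat_inv M)" "mat_inv (mat_inv M) = M"
  using mat_inv_props[OF assms] assms(1) by (auto intro: invertible_matI mat_inv_eqI)

section \<open>Inverting triangular and antitriangular matrices without determinants\<close>

text \<open>Telescoping with \<open>S\<close> = 1 + \<open>N\<close> + ... +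
  \<open>N ^\<^sub>m (k - 1)\<close>. The same \<open>S\<close> works on both sides since powers of
  \<open>N\<close> commute with \<open>N\<close>, so a nilpotent \<open>N\<close> yields a two-sided
  inverse of 1 - \<open>N\<close>.\<close>

lemma geometric_sum_mat:
  fixes N :: "'a :: ring_1 mat"
  assumes N: "N \<in> carrier_mat n n"
  shows "\<exists>S \<in> carrier_mat n n. (1\<^sub>m n - N) * S = 1\<^sub>m n - N ^\<^sub>m k \<and> S * (1\<^sub>m n - N) = 1\<^sub>m n - N ^\<^sub>m k"
proof (induction k)
  case 0
  have "1\<^sub>m n - 1\<^sub>m n = (0\<^sub>m n n :: 'a mat)"
    by auto
  then show ?case
    using N by (intro bexI[of _ "0\<^sub>m n n"]) auto
next
  case (Suc k)
  then obtain S where S: "S \<in> carrier_mat n n"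
    "(1\<^sub>m n - N) * S = 1\<^sub>m n - N ^\<^sub>m k" "S * (1\<^sub>m n - N) = 1\<^sub>m n - N ^\<^sub>m k"
    by blast
  have P: "N ^\<^sub>m k \<in> carrier_mat n n" and Q: "N ^\<^sub>m Suc k \<in> carrier_mat n n"
    using N by auto
  have NP: "N * N ^\<^sub>m k = N ^\<^sub>m Suc k"
    using pow_mat_add[OF N, of 1 k] N by simp
  have D: "1\<^sub>m n - N \<in> carrier_mat n n"
    using N by (rule minus_carrier_mat)
  have eq: "1\<^sub>m n - N ^\<^sub>m k + (N ^\<^sub>m k - N ^\<^sub>m Suc k) = 1\<^sub>m n - N ^\<^sub>m Suc k"
    by (intro eq_matI) (simp_all add: carrier_matD[OF P] carrier_matD[OF Q] del: pow_mat.simps pow_mat_dim)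
  have "(1\<^sub>m n - N) * (S + N ^\<^sub>m k) = 1\<^sub>m n - N ^\<^sub>m Suc k"
    using mult_add_distrib_mat[OF D S(1) P] minus_mult_distrib_mat[OF one_carrier_mat N P]
      left_mult_one_mat[OF P] NP S(2) eq
    by (simp only:)
  moreover have "(S + N ^\<^sub>m k) * (1\<^sub>m n - N) = 1\<^sub>m n - N ^\<^sub>m Suc k"
    using add_mult_distrib_mat[OF S(1) P D] mult_minus_distrib_mat[OF P one_carrier_mat N]
      right_mult_one_mat[OF P] S(3) eq
    by (simp only: pow_mat.simps)
  ultimately show ?case
    using S(1) P by (intro bexI[of _ "S + N ^\<^sub>m k"]) auto
qed

text \<open>Each factor \<open>N\<close> pushes the possible nonzero entries one diagonal further
  down. At \<open>k\<close> = \<open>n\<close> the first premise always holds, so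
  \<open>N ^\<^sub>m n\<close> vanishes.\<close>

lemma strictly_lower_triangular_pow_mat:
  fixes N :: "'a :: semiring_1 mat"
  assumes N: "N \<in> carrier_mat n n" and zero: "\<And>i j. i \<le> j \<Longrightarrow> j < n \<Longrightarrow> N $$ (i, j) = 0"
  shows "i < j + k \<Longrightarrow> i < n \<Longrightarrow> j < n \<Longrightarrow> (N ^\<^sub>m k) $$ (i, j) = 0"
proof (induction k arbitrary: j)
  case 0
  then show ?case using N by simp
next
  case (Suc k)
  \<comment> \<open>If \<open>l\<close> is at most \<open>j\<close>, the second factor is 0.
    Otherwise \<open>i\<close> < \<open>j + Suc k\<close> gives \<open>i\<close> <
    \<open>l + k\<close>, and the induction hypothesis makes the first factor 0.\<close>
  have "(N ^\<^sub>m k) $$ (i, l) * N $$ (l, j) = 0" if "l < n" for l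
    using Suc zero[of l j] that by (cases "l \<le> j") auto
  then show ?case
    using Suc.prems N by (simp add: scalar_prod_def)
qed

lemma invertible_lower_unitriangular:
  fixes L :: "'a :: ring_1 mat"
  assumes L: "L \<in> carrier_mat n n"
    and diag: "\<And>i. i < n \<Longrightarrow> L $$ (i, i) = 1"
    and upper: "\<And>i j. i < j \<Longrightarrow> j < n \<Longrightarrow> L $$ (i, j) = 0"
  shows "invertible_mat L"
proof -
  define N where "N = 1\<^sub>m n - L"
  have N: "N \<in> carrier_mat n n"
    using L unfolding N_def by (rule minus_carrier_mat)
  have zero: "N $$ (i, j) = 0" if "i \<le> j" "j < n" for i j
    using that L diag upper by (cases "i = j") (auto simp: N_def)
  have "N ^\<^sub>m n = 0\<^sub>m n n"
    using strictly_lower_triangular_pow_mat[OF N zero] N by (intro eq_matI) auto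
  moreover have "1\<^sub>m n - N = L"
    using L unfolding N_def by (intro eq_matI) auto
  moreover have "1\<^sub>m n - 0\<^sub>m n n = (1\<^sub>m n :: 'a mat)"
    by auto
  ultimately show ?thesis
    using geometric_sum_mat[OF N, of n] L invertible_matI by auto
qed

lemma invertible_antitriangular:
  fixes H :: "'a :: ring_1 mat"
  assumes H: "H \<in> carrier_mat n n"
    and antidiag: "\<And>i j. i + j + 1 = n \<Longrightarrow> H $$ (i, j) = 1"
    and above: "\<And>i j. i + j + 1 < n \<Longrightarrow> H $$ (i, j) = 0"
  shows "invertible_mat H"
proof -
  \<comment> \<open>\<open>J\<close> is the reversal permutation: right multiplication by it
    reverses the columns. It is its own inverse, so \<open>H\<close> is recovered as
    \<open>(H * J) * J\<close>.\<close>
  define J :: "'a mat" where "J = mat n n (\<lambda>(i, j). if i = n - 1 - j then 1 else 0)"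
  have J: "J \<in> carrier_mat n n"
    by (simp add: J_def)
  have entry: "(M * J) $$ (i, j) = M $$ (i, n - 1 - j)"
    if "M \<in> carrier_mat n n" "i < n" "j < n" for M i j
  proof -
    have "col J j = unit_vec n (n - 1 - j)"
      using that by (intro eq_vecI) (auto simp: J_def)
    then show ?thesis
      using that J scalar_prod_right_unit[of "n - 1 - j" n "row M i"] by simp
  qed
  have JJ: "J * J = 1\<^sub>m n"
  proof (rule eq_matI)
    fix i j
    assume "i < dim_row (1\<^sub>m n :: 'a mat)" "j < dim_col (1\<^sub>m n :: 'a mat)"
    then have "i < n" "j < n"
      by simp_all
    then show "(J * J) $$ (i, j) = 1\<^sub>m n $$ (i, j)"
      using entry[OF J, of i j] by (auto simp: J_def simp del: index_mult_mat(1))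
  qed (use J in auto)
  then have invJ: "invertible_mat J"
    using invertible_matI J by blast
  have "invertible_mat (H * J)"
  proof (rule invertible_lower_unitriangular)
    show "(H * J) $$ (i, i) = 1" if "i < n" for i
      using that entry[OF H] antidiag[of i "n - 1 - i"] by simp
    show "(H * J) $$ (i, j) = 0" if "i < j" "j < n" for i j
      using that entry[OF H, of i j] above[of i "n - 1 - j"] by simp
  qed (use H J in simp)
  then have "invertible_mat ((H * J) * J)"
    using invertible_mat_mult[OF mult_carrier_mat[OF H J] _ J invJ] by simp
  then show ?thesis
    using H J JJ by simp
qed

section \<open>Products of Krylov rows with controllability columns\<close>

lemma row_krylov_mat_carrier [simp]:
  "row_krylov_mat n t A \<in> carrier_mat n n"
  "dim_row (row_krylov_mat n t A) = n" "dim_col (row_krylov_mat n t A) = n"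
  unfolding row_krylov_mat_def by auto

lemma row_row_krylov_mat:
  assumes "A \<in> carrier_mat n n" "i < n"
  shows "row (row_krylov_mat n t A) i = row (t * A ^\<^sub>m i) 0"
proof -
  have "A ^\<^sub>m i \<in> carrier_mat n n"
    using assms by simp
  then show ?thesis
    using assms(2)
    by (intro eq_vecI) (auto simp: row_krylov_mat_def mat_of_rows_index simp del: pow_mat_dim)
qed

lemma controllability_mat_carrier [simp]:
  "controllability_mat n A B \<in> carrier_mat n n"
  "dim_row (controllability_mat n A B) = n" "dim_col (controllability_mat n A B) = n"
  unfolding controllability_mat_def by auto

lemma col_controllability_mat:
  assumes "A \<in> carrier_mat n n" "B \<in> carrier_vec n" "j < n"
  shows "col (controllability_mat n A B) j = A ^\<^sub>m j *\<^sub>v B"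
  using assms mult_mat_vec_carrier[of "A ^\<^sub>m j" n n B] by (simp add: controllability_mat_def)

text \<open>Associativity read in a single row; it moves powers of \<open>A\<close> between the row
  vector and \<open>B\<close>.\<close>

lemma row_mult_scalar_prod:
  fixes M N :: "'a :: semiring_1 mat"
  assumes "M \<in> carrier_mat m n" "N \<in> carrier_mat n k" "v \<in> carrier_vec k" "i < m"
  shows "row (M * N) i \<bullet> v = row M i \<bullet> (N *\<^sub>v v)"
  using arg_cong[OF assoc_mult_mat_vec[OF assms(1-3)], of "\<lambda>w. w $ i"] assms
  by (simp del: row_mult assoc_mult_mat_vec)

text \<open>The product is a Hankel matrix: its entries depend only on \<open>i + j\<close>.\<close>

lemma row_krylov_mult_controllability:
  fixes A :: "'a :: semiring_1 mat"
  assumes A: "A \<in> carrier_mat n n" and B: "B \<in> carrier_vec n" and t: "t \<in> carrier_mat 1 n"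
    and "i < n" "j < n"
  shows "(row_krylov_mat n t A * controllability_mat n A B) $$ (i, j) = row t 0 \<bullet> (A ^\<^sub>m (i + j) *\<^sub>v B)"
proof -
  have P: "A ^\<^sub>m i \<in> carrier_mat n n" "A ^\<^sub>m j \<in> carrier_mat n n"
    using A by auto
  have "row (t * A ^\<^sub>m i) 0 \<bullet> (A ^\<^sub>m j *\<^sub>v B) = row t 0 \<bullet> (A ^\<^sub>m i *\<^sub>v (A ^\<^sub>m j *\<^sub>v B))"
    using P B t by (intro row_mult_scalar_prod) auto
  then show ?thesis
    using assms P pow_mat_add[OF A, of i j] assoc_mult_mat_vec[OF P B]
    by (simp add: row_row_krylov_mat col_controllability_mat del: row_mult)
qed

section \<open>The row vector t and its Krylov matrix\<close>

lemma row_companion_row: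
  assumes "n \<ge> 1" "invertible_mat (controllability_mat n A B)"
  shows "row (companion_row n A B) 0 = row (mat_inv (controllability_mat n A B)) (n - 1)"
  using assms mat_inv_props(1)[OF controllability_mat_carrier(1) assms(2)]
  by (intro eq_vecI) (auto simp: companion_row_def)

lemma companion_row_carrier:
  assumes "invertible_mat (controllability_mat n A B)"
  shows "companion_row n A B \<in> carrier_mat 1 n"
  using mat_inv_props(1)[OF controllability_mat_carrier(1) assms] by (auto simp: companion_row_def)

lemma mat_of_row_unit_vec_carrier: "mat_of_row (unit_vec n k) \<in> carrier_mat 1 n"
  by auto

lemma companion_row_mult_controllability:
  assumes "invertible_mat (controllability_mat n A B)"
  shows "companion_row n A B * controllability_mat n A B = mat_of_row (unit_vec n (n - 1))"
proof -
  note inv = mat_inv_props[OF controllability_mat_carrier(1) assms]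
  show ?thesis
    using assoc_mult_mat[OF mat_of_row_unit_vec_carrier inv(1) controllability_mat_carrier(1)[of n A B]] inv(3)
      right_mult_one_mat[OF mat_of_row_unit_vec_carrier]
    by (simp add: companion_row_def)
qed

lemma companion_row_unique:
  assumes "invertible_mat (controllability_mat n A B)" and s: "s \<in> carrier_mat 1 n"
    and "s * controllability_mat n A B = mat_of_row (unit_vec n (n - 1))"
  shows "s = companion_row n A B"
proof -
  note inv = mat_inv_props[OF controllability_mat_carrier(1) assms(1)]
  show ?thesis
    using assoc_mult_mat[OF s controllability_mat_carrier(1)[of n A B] inv(1)] inv(2) assms(3) s
    by (simp add: companion_row_def)
qed

lemma companion_row_scalar_prod:
  fixes A :: "'a :: ring_1 mat"
  assumes A: "A \<in> carrier_mat n n" and B: "B \<in> carrier_vec n"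
    and inv: "invertible_mat (controllability_mat n A B)" and j: "j < n"
  shows "row (companion_row n A B) 0 \<bullet> (A ^\<^sub>m j *\<^sub>v B) = (if j = n - 1 then 1 else 0)"
  using arg_cong[OF companion_row_mult_controllability[OF inv], of "\<lambda>M. M $$ (0, j)"]
    companion_row_carrier[OF inv] assms
  by (auto simp: col_controllability_mat)

lemma invertible_row_krylov_mat:
  fixes A :: "'a :: ring_1 mat"
  assumes A: "A \<in> carrier_mat n n" and B: "B \<in> carrier_vec n"
    and inv: "invertible_mat (controllability_mat n A B)"
  shows "invertible_mat (row_krylov_mat n (companion_row n A B) A)"
proof -
  let ?C = "controllability_mat n A B" and ?K = "row_krylov_mat n (companion_row n A B) A"
  note iC = mat_inv_props[OF controllability_mat_carrier(1) inv]
  \<comment> \<open>The entries with \<open>i + j\<close> at least \<open>n\<close> involve powers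
    of \<open>A\<close> beyond those in \<open>?C\<close>. The antitriangular criterion asks nothing
    of them.\<close>
  have "invertible_mat (?K * ?C)"
    by (rule invertible_antitriangular[of _ n])
       (auto simp: row_krylov_mult_controllability[OF A B companion_row_carrier[OF inv]]
          companion_row_scalar_prod[OF A B inv] simp del: index_mult_mat(1))
  then have "invertible_mat ((?K * ?C) * mat_inv ?C)"
    using iC(1) invertible_mat_inv(1)[OF controllability_mat_carrier(1) inv]
      mult_carrier_mat[OF row_krylov_mat_carrier(1) controllability_mat_carrier(1)]
    by (intro invertible_mat_mult[of "?K * ?C" n]) assumption+
  then show ?thesis
    using assoc_mult_mat[OF row_krylov_mat_carrier(1) controllability_mat_carrier(1)[of n A B] iC(1)] iC(2)
    by (simp add: right_mult_one_mat[OF row_krylov_mat_carrier(1)])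
qed

section \<open>Existence and uniqueness of the transformation\<close>

lemma companion_transform_exists:
  fixes A :: "'a :: ring_1 mat"
  assumes n: "n \<ge> 1" and A: "A \<in> carrier_mat n n" and B: "B \<in> carrier_vec n"
    and inv: "invertible_mat (controllability_mat n A B)"
  shows "companion_transform n A B (mat_inv (row_krylov_mat n (companion_row n A B) A))"
proof -
  define t where "t = companion_row n A B"
  define K where "K = row_krylov_mat n t A"
  define T where "T = mat_inv K"
  have t: "t \<in> carrier_mat 1 n"
    using companion_row_carrier[OF inv] by (simp add: t_def)
  have K: "K \<in> carrier_mat n n" "invertible_mat K"
    using invertible_row_krylov_mat[OF A B inv] by (simp_all add: K_def t_def)
  note T = mat_inv_props[OF K, folded T_def] and iT = invertible_mat_inv[OF K, folded T_def]
  have rowK: "row K i = row (t * A ^\<^sub>m i) 0" if "i < n" for i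
    using row_row_krylov_mat[OF A that] by (simp add: K_def)
  have KA: "row (K * A) i = row K (i + 1)" if "i + 1 < n" for i
  proof -
    have "row (K * A) i = row ((t * A ^\<^sub>m i) * A) 0"
      using that K A t rowK[of i] by (intro eq_vecI) (auto simp del: assoc_mult_mat row_mult)
    also have "\<dots> = row (t * A ^\<^sub>m (i + 1)) 0"
      using assoc_mult_mat[OF t _ A, of "A ^\<^sub>m i"] A by simp
    finally show ?thesis
      using rowK[OF that] by simp
  qed
  \<comment> \<open>The coefficients are read off the last row of \<open>K * A * T\<close>, so that
    row agrees by construction. By \<open>KA\<close>, any other row \<open>i\<close> is row
    \<open>i + 1\<close> of \<open>K * T\<close>, the identity matrix.\<close>
  have comp: "K * A * T = lower_companion_mat n (\<lambda>j. - (K * A * T) $$ (n - 1, j))" (is "_ = ?R")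
  proof (rule eq_matI)
    fix i j
    assume "i < dim_row ?R" "j < dim_col ?R"
    then have ij: "i < n" "j < n"
      by (simp_all add: lower_companion_mat_def)
    show "(K * A * T) $$ (i, j) = ?R $$ (i, j)"
    proof (cases "i = n - 1")
      case True
      then show ?thesis
        using ij by (simp add: lower_companion_mat_def)
    next
      case False
      then have i: "i + 1 < n"
        using ij by simp
      have "(K * A * T) $$ (i, j) = row (K * A) i \<bullet> col T j"
        using ij K T by (simp del: assoc_mult_mat row_mult)
      also have "\<dots> = (K * T) $$ (i + 1, j)"
        using i ij K(1) T(1) by (simp add: KA[OF i] del: row_mult)
      finally show ?thesis
        using i ij False by (simp add: lower_companion_mat_def T(2))
    qed
  qed (use K A T in \<open>auto simp: lower_companion_mat_def\<close>)
  \<comment> \<open>Entry \<open>i\<close> is \<open>t A\<^sup>i B\<close>, which is entry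
    \<open>i\<close> of \<open>t\<close> times the controllability matrix.\<close>
  have KB: "K *\<^sub>v B = unit_vec n (n - 1)"
  proof (rule eq_vecI)
    fix i
    assume "i < dim_vec (unit_vec n (n - 1) :: 'a vec)"
    then have i: "i < n"
      by simp
    have "(K *\<^sub>v B) $ i = row t 0 \<bullet> (A ^\<^sub>m i *\<^sub>v B)"
      using i K rowK[OF i] row_mult_scalar_prod[OF t _ B, of "A ^\<^sub>m i" 0] A by simp
    then show "(K *\<^sub>v B) $ i = unit_vec n (n - 1) $ i"
      using companion_row_scalar_prod[OF A B inv i] i by (simp add: t_def)
  qed (use K in simp)
  have "lower_companion_form n (K * A * T) (K *\<^sub>v B)"
    unfolding lower_companion_form_def using comp KB by blast
  then have "companion_transform n A B T"
    using T(1) iT by (simp add: companion_transform_def)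
  then show ?thesis
    by (simp only: T_def K_def t_def)
qed

lemma companion_transform_imp:
  fixes A :: "'a :: ring_1 mat"
  assumes n: "n \<ge> 1" and A: "A \<in> carrier_mat n n" and B: "B \<in> carrier_vec n"
    and inv: "invertible_mat (controllability_mat n A B)"
    and trans: "companion_transform n A B T"
  shows "mat_inv T = row_krylov_mat n (companion_row n A B) A"
proof -
  define S where "S = mat_inv T"
  have T: "T \<in> carrier_mat n n" "invertible_mat T"
    using trans by (auto simp: companion_transform_def)
  note S = mat_inv_props[OF T, folded S_def]
  obtain a where SAT: "S * A * T = lower_companion_mat n a" and SB: "S *\<^sub>v B = unit_vec n (n - 1)"
    using trans by (auto simp: companion_transform_def lower_companion_form_def S_def)
  \<comment> \<open>Inserting \<open>T * S\<close> = 1 turns the similarity into an intertwining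
    relation, in which the companion matrix acts on the rows of \<open>S\<close>.\<close>
  have "S * A = S * A * (T * S)"
    using S A T by simp
  also have "\<dots> = S * A * T * S"
    using assoc_mult_mat[of "S * A" n n T n S n] S(1) A T by (simp del: assoc_mult_mat)
  finally have SA: "S * A = lower_companion_mat n a * S"
    by (simp only: SAT)
  \<comment> \<open>Every row of the companion matrix but the last is a unit vector, and multiplying
    it by \<open>S\<close> selects the next row of \<open>S\<close>.\<close>
  have step: "row (S * A) i = row S (i + 1)" if i: "i + 1 < n" for i
  proof (rule eq_vecI)
    fix j
    assume "j < dim_vec (row S (i + 1))"
    then have j: "j < n"
      using S by simp
    have "row (lower_companion_mat n a) i = unit_vec n (i + 1)"
      using i by (intro eq_vecI) (auto simp: lower_companion_mat_def)
    then show "row (S * A) i $ j = row S (i + 1) $ j"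
      unfolding SA using i j S(1) by (simp add: lower_companion_mat_def)
  qed (use S A in simp)
  define s where "s = mat_of_row (row S 0)"
  have s: "s \<in> carrier_mat 1 n"
    using S by (auto simp: s_def)
  have rows: "row (s * A ^\<^sub>m i) 0 = row S i" if "i < n" for i
    using that
  proof (induction i)
    case 0
    then show ?case
      using A right_mult_one_mat[OF s] by (simp add: s_def)
  next
    case (Suc i)
    have "s * A ^\<^sub>m Suc i = (s * A ^\<^sub>m i) * A"
      using assoc_mult_mat[OF s _ A, of "A ^\<^sub>m i"] A by simp
    then have "row (s * A ^\<^sub>m Suc i) 0 = row (S * A) i"
      using Suc s A S(1) by (intro eq_vecI) (auto simp del: assoc_mult_mat row_mult)
    then show ?case
      using step[of i] Suc.prems by simp
  qed
  \<comment> \<open>Entry \<open>j\<close> is \<open>s A\<^sup>j B\<close>, and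
    \<open>s A\<^sup>j\<close> is row \<open>j\<close> of \<open>S\<close>; hence the product lists
    the entries of \<open>S *\<^sub>v B\<close>, which is the last unit vector.\<close>
  have "s * controllability_mat n A B = mat_of_row (unit_vec n (n - 1))"
  proof (rule eq_matI)
    fix i j
    assume "i < dim_row (mat_of_row (unit_vec n (n - 1) :: 'a vec))"
      "j < dim_col (mat_of_row (unit_vec n (n - 1) :: 'a vec))"
    then have i: "i = 0" and j: "j < n"
      by simp_all
    have "(s * controllability_mat n A B) $$ (0, j) = row s 0 \<bullet> (A ^\<^sub>m j *\<^sub>v B)"
      using s j by (simp add: col_controllability_mat[OF A B])
    also have "\<dots> = row S j \<bullet> B"
      using row_mult_scalar_prod[OF s _ B, of "A ^\<^sub>m j" 0] A rows[OF j] by simp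
    also have "\<dots> = (S *\<^sub>v B) $ j"
      using j S by simp
    finally show "(s * controllability_mat n A B) $$ (i, j) = mat_of_row (unit_vec n (n - 1)) $$ (i, j)"
      using SB i j by simp
  qed (use s in auto)
  then have "s = companion_row n A B"
    using companion_row_unique[OF inv s] by simp
  moreover have "S = row_krylov_mat n s A"
    using S rows by (intro eq_rowI) (auto simp: row_row_krylov_mat[OF A])
  ultimately show ?thesis
    by (simp add: S_def)
qed

theorem theorem1:
  fixes n :: nat and A :: "quat mat" and B :: "quat vec"
  assumes "n \<ge> 1"
    and "A \<in> carrier_mat n n"
    and "B \<in> carrier_vec n"
    and "invertible_mat (controllability_mat n A B)"
  shows "(\<exists>T. companion_transform n A B T) \<and>
    (\<forall>T. companion_transform n A B T \<longrightarrow>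
      mat_inv T = row_krylov_mat n (companion_row n A B) A) \<and>
    row (companion_row n A B) 0 = row (mat_inv (controllability_mat n A B)) (n - 1) \<and>
    (\<exists>!T. companion_transform n A B T) \<and>
    (\<exists>!P. \<exists>T. companion_transform n A B T \<and> P = (mat_inv T * A * T, mat_inv T *\<^sub>v B))"
proof -
  let ?K = "row_krylov_mat n (companion_row n A B) A"
  note ex = companion_transform_exists[OF assms] and imp = companion_transform_imp[OF assms]
  \<comment> \<open>The inverse of \<open>T\<close> is determined by \<open>A\<close> and
    \<open>B\<close>; inverting once more determines \<open>T\<close> itself.\<close>
  have "T = mat_inv ?K" if "companion_transform n A B T" for T
    using imp[OF that] invertible_mat_inv(2)[of T n] that by (auto simp: companion_transform_def)
  then have "\<exists>!T. companion_transform n A B T"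
    using ex by blast
  \<comment> \<open>The companion pair is a function of \<open>T\<close>, so its uniqueness follows
    from that of \<open>T\<close>.\<close>
  then show ?thesis
    using imp row_companion_row[OF assms(1,4)] by blast
qed

end
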